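(* Let $n,k$ be integers with $n\geq 2$ and $k\geq 3$. Then $$ex_{\mathcal{OP}}(n,C_k)\leq \frac{(2k - 5)(kn - k - 1)}{k^2 - 2k - 1}.$$
   Context: All graphs are finite, undirected, without loops or multiple edges. A graph is outerplanar if it has a planar drawing (edge curves do not cross; they may share only endpoints) for which all vertices belong to the outer face of the drawing. $C_k$ denotes the cycle on $k$ vertices. For a graph $H$, the outerplanar Turán number $ex_{\mathcal{OP}}(n,H)$ is the maximum number of edges in an $n$-vertex outerplanar graph that does not contain $H$ as a (not necessarily induced) subgraph. *)

theory Defs
  imports "HOL-Analysis.Analysis"
begin

type_synonym 'a graph = "'a set \<times> 'a set set"

abbreviation verts :: "'a graph \<Rightarrow> 'a set" where
  "verts G \<equiv> fst G"

abbreviation edges :: "'a graph \<Rightarrow> 'a set set" where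
  "edges G \<equiv> snd G"

definition simple_graph :: "'a graph \<Rightarrow> bool" where
  "simple_graph G \<longleftrightarrow> finite (verts G) \<and> (\<forall>e\<in>edges G. e \<subseteq> verts G \<and> card e = 2)"

(* G has a (not necessarily induced) subgraph isomorphic to H. *)
definition contains_subgraph :: "'a graph \<Rightarrow> 'b graph \<Rightarrow> bool" where
  "contains_subgraph G H \<longleftrightarrow>
     (\<exists>f. inj_on f (verts H) \<and> f ` verts H \<subseteq> verts G \<and> (\<forall>e\<in>edges H. f ` e \<in> edges G))"

(* This is the cycle C_k only for k >= 3. *)
definition cycle_graph :: "nat \<Rightarrow> nat graph" where
  "cycle_graph k = ({..<k}, {{i, Suc i mod k} | i. i < k})"

(* Vertex v is drawn as the point p v, and edge e as the simple arc c e joining the images of its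
   two ends. An edge curve meets no vertex other than its own ends, and two different edge curves
   meet at most in common ends. *)
definition planar_drawing :: "'a graph \<Rightarrow> ('a \<Rightarrow> complex) \<Rightarrow> ('a set \<Rightarrow> real \<Rightarrow> complex) \<Rightarrow> bool" where
  "planar_drawing G p c \<longleftrightarrow>
     inj_on p (verts G) \<and>
     (\<forall>e\<in>edges G. arc (c e) \<and> {pathstart (c e), pathfinish (c e)} = p ` e) \<and>
     (\<forall>e\<in>edges G. \<forall>v\<in>verts G. p v \<in> path_image (c e) \<longrightarrow> v \<in> e) \<and>
     (\<forall>e\<in>edges G. \<forall>e'\<in>edges G. e \<noteq> e' \<longrightarrow>
        path_image (c e) \<inter> path_image (c e') \<subseteq> p ` e \<inter> p ` e')"

definition drawing_image :: "'a graph \<Rightarrow> ('a \<Rightarrow> complex) \<Rightarrow> ('a set \<Rightarrow> real \<Rightarrow> complex) \<Rightarrow> complex set" where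
  "drawing_image G p c = p ` verts G \<union> (\<Union>e\<in>edges G. path_image (c e))"

(* The drawing of a finite graph is compact, so "outside" of it is the unique unbounded face, that
   is, the outer face. Vertices belong to a face if they lie on its boundary. *)
definition outerplanar :: "'a graph \<Rightarrow> bool" where
  "outerplanar G \<longleftrightarrow>
     (\<exists>p c. planar_drawing G p c \<and> p ` verts G \<subseteq> frontier (outside (drawing_image G p c)))"

(* Every finite graph is isomorphic to one whose vertices are natural numbers. The set below is
   finite; the maximum is only meaningful if the set is nonempty, which holds for every H with at
   least one edge (see ex_OP_attained). *)
definition ex_OP :: "nat \<Rightarrow> 'b graph \<Rightarrow> nat" where
  "ex_OP n H = Max {card (edges G) | G :: nat graph.
     simple_graph G \<and> card (verts G) = n \<and> outerplanar G \<and> \<not> contains_subgraph G H}"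

lemma simple_graph_card_edges_le:
  assumes "simple_graph G"
  shows "card (edges G) \<le> 2 ^ card (verts G)"
proof -
  have "edges G \<subseteq> Pow (verts G)" "finite (verts G)"
    using assms by (auto simp: simple_graph_def)
  then show ?thesis
    by (metis card_Pow card_mono finite_Pow_iff)
qed

lemma outerplanar_edgeless:
  fixes V :: "nat set"
  assumes "finite V"
  shows "outerplanar (V, {})"
proof -
  let ?p = "\<lambda>v::nat. of_nat v :: complex"
  let ?S = "?p ` V"
  have fin: "finite ?S"
    using assms by simp
  have conn: "connected (- ?S)"
    using fin by (intro path_connected_imp_connected path_connected_complement_countable countable_finite) simp_all
  have unb: "\<not> bounded (- ?S)"
    using fin by (intro cobounded_imp_unbounded) (simp add: finite_imp_bounded)
  have "outside ?S = - ?S"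
    using conn unb by (auto simp: outside_def connected_component_eq_self)
  moreover have "interior ?S = {}"
    using fin by (metis finite_subset interior_subset open_interior finite_imp_not_open)
  then have "frontier ?S = ?S"
    using fin by (simp add: frontier_def finite_imp_closed)
  ultimately have "?S \<subseteq> frontier (outside ?S)"
    by simp
  then show ?thesis
    unfolding outerplanar_def planar_drawing_def drawing_image_def
    by (intro exI[of _ ?p] exI[of _ undefined]) (simp add: inj_on_def)
qed

lemma finite_ex_OP_set:
  "finite {card (edges G) | G :: nat graph.
     simple_graph G \<and> card (verts G) = n \<and> outerplanar G \<and> \<not> contains_subgraph G H}"
proof (rule finite_subset)
  show "{card (edges G) | G :: nat graph.
     simple_graph G \<and> card (verts G) = n \<and> outerplanar G \<and> \<not> contains_subgraph G H} \<subseteq> {..2 ^ n}"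
    using simple_graph_card_edges_le by fastforce
qed simp

lemma ex_OP_attained:
  assumes "edges H \<noteq> {}"
  obtains G :: "nat graph" where "simple_graph G" "card (verts G) = n" "outerplanar G"
    "\<not> contains_subgraph G H" "card (edges G) = ex_OP n H"
proof -
  let ?A = "{card (edges G) | G :: nat graph.
     simple_graph G \<and> card (verts G) = n \<and> outerplanar G \<and> \<not> contains_subgraph G H}"
  let ?G = "({..<n}, {}) :: nat graph"
  have "simple_graph ?G \<and> card (verts ?G) = n \<and> outerplanar ?G \<and> \<not> contains_subgraph ?G H"
    using assms outerplanar_edgeless[of "{..<n}"]
    by (auto simp: simple_graph_def contains_subgraph_def)
  then have "?A \<noteq> {}"
    by blast
  then have "Max ?A \<in> ?A"
    using finite_ex_OP_set by (rule Max_in[rotated])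
  then show ?thesis
    using that unfolding ex_OP_def by fastforce
qed

end

theory Submission
  imports Defs "HOL-Complex_Analysis.Winding_Numbers"
begin

text \<open>
  An outerplanar graph has no three internally disjoint paths of length at least 2 with common ends,
  since one of them would run inside the cycle formed by the other two. Hence a longest cycle of
  a graph without cut vertices is Hamiltonian, and its chords do not cross because each of them runs
  inside the cycle. Graphs with a cut vertex are handled by adding up the bounds for the two sides.

  In the Hamiltonian case the vertices are numbered along the cycle. For a chord \<open>(a, b)\<close>, let
  \<open>N = b - a\<close> and let \<open>e\<close> be the number of edges within \<open>{a..b}\<close>. Put
  \<open>\<alpha> = k (2 k - 5)\<close> and \<open>\<beta> = k^2 - 2 k - 1\<close>. By induction on \<open>N\<close> there is a
  \<open>t \<le> k - 3\<close> such that \<open>a\<close> and \<open>b\<close> are joined within \<open>{a..b}\<close> by paths of all lengths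
  \<open>1, \<dots>, t + 1\<close>, and \<open>\<alpha> N - \<beta> e \<ge> \<alpha> - \<beta> - (k - 2) t\<close>. Indeed, let the inner face at
  \<open>(a, b)\<close> have \<open>r\<close> further edges, with parameters adding up to \<open>T\<close>. Then \<open>a\<close> and \<open>b\<close> are
  joined by paths of all lengths \<open>r, \<dots>, r + T\<close>. If \<open>r = 2\<close>, take \<open>t = T + 1\<close>. Otherwise
  \<open>t = 0\<close> works, because the absence of a \<open>k\<close>-cycle forces \<open>r + T \<le> k - 2\<close> or \<open>r \<ge> k\<close>.
\<close>

section \<open>Theta graphs in the plane\<close>

text \<open>
  If the interiors of all three arcs were outside the other two, then the insides of the three cycles
  would be pairwise different components of the complement. But the winding numbers of the three
  cycles add up to 0, so a point inside one of them is inside another one as well.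
\<close>

lemma theta_inside:
  fixes g1 g2 g3 :: "real \<Rightarrow> complex"
  assumes arcs: "arc g1" "arc g2" "arc g3"
    and start: "pathstart g1 = a" "pathstart g2 = a" "pathstart g3 = a"
    and finish: "pathfinish g1 = b" "pathfinish g2 = b" "pathfinish g3 = b"
    and int12: "path_image g1 \<inter> path_image g2 = {a, b}"
    and int13: "path_image g1 \<inter> path_image g3 = {a, b}"
    and int23: "path_image g2 \<inter> path_image g3 = {a, b}"
    and out1: "path_image g1 \<inter> outside (path_image g2 \<union> path_image g3) \<noteq> {}"
    and out2: "path_image g2 \<inter> outside (path_image g1 \<union> path_image g3) \<noteq> {}"
  shows "path_image g3 - {a, b} \<subseteq> inside (path_image g1 \<union> path_image g2)"
proof -
  let ?P = path_image
  have loop: "simple_path (g +++ reversepath h) \<and> pathfinish (g +++ reversepath h) = pathstart (g +++ reversepath h)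
      \<and> ?P (g +++ reversepath h) = ?P g \<union> ?P h"
    if "arc g" "arc h" "pathstart g = a" "pathstart h = a" "pathfinish g = b" "pathfinish h = b"
      "?P g \<inter> ?P h = {a, b}" for g h
    using that by (auto simp: path_image_join intro!: simple_path_join_loop arc_reversepath)
  have jordan: "open (inside (?P g \<union> ?P h)) \<and> connected (inside (?P g \<union> ?P h)) \<and>
      inside (?P g \<union> ?P h) \<noteq> {} \<and> frontier (inside (?P g \<union> ?P h)) = ?P g \<union> ?P h"
    if "arc g" "arc h" "pathstart g = a" "pathstart h = a" "pathfinish g = b" "pathfinish h = b"
      "?P g \<inter> ?P h = {a, b}" for g h
    using loop[OF that] Jordan_inside_outside[of "g +++ reversepath h"] by auto
  \<comment> \<open>The loop \<open>g +++ reversepath h\<close> has winding number w(g) - w(h),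
    which is of norm 1 inside and 0 outside. So comparing the winding numbers of the open arcs
    \<open>g1\<close>, \<open>g2\<close>, \<open>g3\<close> at \<open>z\<close> tells which of the
    three cycles enclose \<open>z\<close>.\<close>
  have wind: "z \<in> inside (?P g \<union> ?P h) \<Longrightarrow> winding_number g z \<noteq> winding_number h z"
      "z \<notin> ?P g \<union> ?P h \<Longrightarrow> winding_number g z \<noteq> winding_number h z \<Longrightarrow> z \<in> inside (?P g \<union> ?P h)"
    if *: "arc g" "arc h" "pathstart g = a" "pathstart h = a" "pathfinish g = b" "pathfinish h = b"
      "?P g \<inter> ?P h = {a, b}" for g h z
  proof -
    have eq: "winding_number (g +++ reversepath h) z = winding_number g z - winding_number h z"
      if "z \<notin> ?P g \<union> ?P h"
      using * that by (subst winding_number_join) (auto simp: arc_imp_path winding_number_reversepath)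
    show "winding_number g z \<noteq> winding_number h z" if z: "z \<in> inside (?P g \<union> ?P h)"
    proof -
      have "z \<notin> ?P g \<union> ?P h" using z inside_no_overlap by blast
      moreover have "norm (winding_number (g +++ reversepath h) z) = 1"
        using simple_closed_path_norm_winding_number_inside[of "g +++ reversepath h" z] loop[OF *] z by auto
      ultimately show ?thesis using eq by auto
    qed
    show "z \<in> inside (?P g \<union> ?P h)" if z: "z \<notin> ?P g \<union> ?P h" "winding_number g z \<noteq> winding_number h z"
    proof (rule ccontr)
      assume "z \<notin> inside (?P g \<union> ?P h)"
      then have "z \<in> outside (?P g \<union> ?P h)"
        using inside_Un_outside[of "?P g \<union> ?P h"] z(1) by blast
      then have "z \<in> outside (?P (g +++ reversepath h))"
        using loop[OF *] by simp
      then have "winding_number (g +++ reversepath h) z = 0"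
        using winding_number_zero_in_outside loop[OF *] simple_path_imp_path by blast
      then show False using eq z by auto
    qed
  qed
  have endless: "connected (?P g - {a, b})" "?P g - {a, b} \<noteq> {}"
    if "arc g" "pathstart g = a" "pathfinish g = b" for g
    using connected_simple_path_endless[of g] nonempty_simple_path_endless[of g] that
    by (auto simp: arc_imp_simple_path)
  \<comment> \<open>The frontier of \<open>outside T\<close> lies in \<open>T\<close>. Hence an arc
    without its ends, being connected and disjoint from \<open>T\<close>, stays in the outside once
    it meets it.\<close>
  have inout: "S - {a,b} \<subseteq> outside T" if "connected (S - {a,b})" "S \<inter> T = {a,b}" "S \<inter> outside T \<noteq> {}" "closed T" for S T :: "complex set"
  proof -
    have "a \<notin> outside T" "b \<notin> outside T" using that outside_no_overlap by blast+
    then have ne: "(S - {a,b}) \<inter> outside T \<noteq> {}" using that by auto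
    have "frontier (outside T) \<subseteq> T" using frontier_outside_subset \<open>closed T\<close> by blast
    then have "(S - {a,b}) \<inter> frontier (outside T) = {}" using that by blast
    then show ?thesis using connected_Int_frontier[OF that(1) ne] by blast
  qed
  have cl: "closed (?P g \<union> ?P h)" if "arc g" "arc h" for g h :: "real \<Rightarrow> complex"
    using that by (simp add: closed_Un closed_path_image arc_imp_path)
  show ?thesis
  proof (rule ccontr)
    assume "\<not> ?thesis"
    then obtain x where x: "x \<in> ?P g3 - {a,b}" "x \<notin> inside (?P g1 \<union> ?P g2)" by blast
    have "x \<notin> ?P g1 \<union> ?P g2" using x int13 int23 by blast
    then have out3: "?P g3 \<inter> outside (?P g1 \<union> ?P g2) \<noteq> {}"
      using x inside_Un_outside[of "?P g1 \<union> ?P g2"] by blast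
    have o1: "?P g1 - {a, b} \<subseteq> outside (?P g2 \<union> ?P g3)"
      by (rule inout) (use endless arcs start finish int12 int13 out1 cl in auto)
    have o2: "?P g2 - {a, b} \<subseteq> outside (?P g1 \<union> ?P g3)"
      by (rule inout) (use endless arcs start finish int12 int23 out2 cl in auto)
    have o3: "?P g3 - {a, b} \<subseteq> outside (?P g1 \<union> ?P g2)"
      by (rule inout) (use endless arcs start finish int13 int23 out3 cl in auto)
    let ?T = "?P g1 \<union> ?P g2 \<union> ?P g3"
    let ?A = "inside (?P g1 \<union> ?P g2)" and ?B = "inside (?P g1 \<union> ?P g3)" and ?C = "inside (?P g2 \<union> ?P g3)"
    have disjI: "inside S \<inter> (S \<union> X) = {}" if "X - {a, b} \<subseteq> outside S" "{a, b} \<subseteq> S" for S X :: "complex set"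
      using that inside_no_overlap[of S] inside_Int_outside[of S] by blast
    have sub: "{a, b} \<subseteq> ?P g1 \<union> ?P g2" "{a, b} \<subseteq> ?P g1 \<union> ?P g3" "{a, b} \<subseteq> ?P g2 \<union> ?P g3"
      using int12 int13 by blast+
    have disj: "?A \<inter> ?T = {}" "?B \<inter> ?T = {}" "?C \<inter> ?T = {}"
      using disjI[OF o3 sub(1)] disjI[OF o2 sub(2)] disjI[OF o1 sub(3)] by (simp_all add: Un_ac)
    have j12: "connected ?A" "?A \<noteq> {}" "frontier ?A = ?P g1 \<union> ?P g2"
      and j13: "connected ?B" "frontier ?B = ?P g1 \<union> ?P g3"
      and j23: "connected ?C" "frontier ?C = ?P g2 \<union> ?P g3"
      using jordan arcs start finish int12 int13 int23 by simp_all
    \<comment> \<open>A connected set that meets \<open>Y\<close> but not its frontier lies in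
      \<open>Y\<close>; this is applied in both directions.\<close>
    have same: "X = Y" if "connected X" "connected Y" "X \<inter> frontier Y = {}" "Y \<inter> frontier X = {}"
      "X \<inter> Y \<noteq> {}" for X Y :: "complex set"
      using connected_Int_frontier[of X Y] connected_Int_frontier[of Y X] that by blast
    obtain z where z: "z \<in> ?A" using j12 by blast
    then have zT: "z \<notin> ?T" using disj by blast
    have "winding_number g1 z \<noteq> winding_number g2 z"
      using wind(1) z arcs start finish int12 by simp
    \<comment> \<open>The third winding number cannot agree with two different values, so
      \<open>z\<close> is enclosed by a second cycle. The two insides then coincide, hence so do
      their frontiers, although each contains an open arc missing from the other.\<close>
    then consider "winding_number g1 z \<noteq> winding_number g3 z" | "winding_number g2 z \<noteq> winding_number g3 z"
      by metis
    then show False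
    proof cases
      case 1
      then have "z \<in> ?B" using wind(2)[of g1 g3 z] zT arcs start finish int13 by simp
      then have "?A = ?B" using same[OF j12(1) j13(1)] z disj unfolding j12(3) j13(2) by blast
      then have "?P g1 \<union> ?P g2 = ?P g1 \<union> ?P g3" using j12 j13 by metis
      then show ?thesis using endless[of g2] arcs start finish int12 int23 by blast
    next
      case 2
      then have "z \<in> ?C" using wind(2)[of g2 g3 z] zT arcs start finish int23 by simp
      then have "?A = ?C" using same[OF j12(1) j23(1)] z disj unfolding j12(3) j23(2) by blast
      then have "?P g1 \<union> ?P g2 = ?P g2 \<union> ?P g3" using j12 j23 by metis
      then show ?thesis using endless[of g1] arcs start finish int12 int13 by blast
    qed
  qed
qed

section \<open>Paths and cycles in outerplanar drawings\<close>

fun path_edges :: "'a list \<Rightarrow> 'a set set" where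
  "path_edges (x # y # zs) = insert {x, y} (path_edges (y # zs))"
| "path_edges _ = {}"

definition cycle_edges :: "'a list \<Rightarrow> 'a set set" where
  "cycle_edges xs = insert {last xs, hd xs} (path_edges xs)"

definition upath :: "'a set set \<Rightarrow> 'a list \<Rightarrow> bool" where
  "upath E xs \<longleftrightarrow> distinct xs \<and> path_edges xs \<subseteq> E"

text \<open>A single edge counts as a cycle of length 2, so that the longest cycle can be grown from an edge.\<close>
definition ucycle :: "'a set set \<Rightarrow> 'a list \<Rightarrow> bool" where
  "ucycle E xs \<longleftrightarrow> distinct xs \<and> 2 \<le> length xs \<and> cycle_edges xs \<subseteq> E"

text \<open>\<open>P\<close>, \<open>Q\<close> and \<open>R\<close> list the inner vertices, so an
  empty list means that the path is the edge \<open>{a, b}\<close>: only three paths of length at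
  least 2 are excluded.\<close>

definition theta_free :: "'a set set \<Rightarrow> bool" where
  "theta_free E \<longleftrightarrow> (\<forall>a b P Q R. upath E (a # P @ [b]) \<and> upath E (a # Q @ [b]) \<and> upath E (a # R @ [b]) \<and>
     set P \<inter> set Q = {} \<and> set P \<inter> set R = {} \<and> set Q \<inter> set R = {} \<longrightarrow> P = [] \<or> Q = [] \<or> R = [])"

text \<open>The ends of the two edges alternate around the cycle. All cycles are covered, not just
  Hamiltonian ones, so that the property passes to subsets of \<open>E\<close> in the induction at
  cut vertices.\<close>

definition crossing_free :: "'a set set \<Rightarrow> bool" where
  "crossing_free E \<longleftrightarrow> (\<forall>xs i j l m. ucycle E xs \<and> i < j \<and> j < l \<and> l < m \<and> m < length xs \<longrightarrow>
     {xs ! i, xs ! l} \<notin> E \<or> {xs ! j, xs ! m} \<notin> E)"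

section \<open>Edge sets of vertex lists\<close>

lemma path_edges_Cons:
  "path_edges (x # ys) = path_edges ys \<union> (if ys = [] then {} else {{x, hd ys}})"
  by (cases ys) auto

lemma path_edges_append:
  "path_edges (xs @ ys) = path_edges xs \<union> path_edges ys \<union>
     (if xs = [] \<or> ys = [] then {} else {{last xs, hd ys}})"
  by (induction xs) (auto simp: path_edges_Cons)

lemma path_edges_rev [simp]: "path_edges (rev xs) = path_edges xs"
  by (induction xs) (auto simp: path_edges_Cons path_edges_append last_rev insert_commute)

lemma Union_path_edges: "2 \<le> length xs \<Longrightarrow> \<Union> (path_edges xs) = set xs"
proof (induction xs rule: path_edges.induct)
  case (1 x y zs)
  then show ?case by (cases zs) auto
qed auto

lemma path_edges_subset: "e \<in> path_edges xs \<Longrightarrow> e \<subseteq> set xs"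
  by (induction xs rule: path_edges.induct) auto

lemma path_edges_nth: "path_edges xs = {{xs ! i, xs ! Suc i} | i. Suc i < length xs}"
proof (induction xs rule: path_edges.induct)
  case (1 x y zs)
  show ?case unfolding path_edges.simps 1
  proof (intro subset_antisym subsetI)
    fix e assume "e \<in> insert {x, y} {{(y # zs) ! i, (y # zs) ! Suc i} |i. Suc i < length (y # zs)}"
    then consider "e = {x, y}" | i where "e = {(y # zs) ! i, (y # zs) ! Suc i}" "Suc i < length (y # zs)" by auto
    then show "e \<in> {{(x # y # zs) ! i, (x # y # zs) ! Suc i} |i. Suc i < length (x # y # zs)}"
      by cases (force intro: exI[of _ 0], force intro: exI[of _ "Suc _"])
  next
    fix e assume "e \<in> {{(x # y # zs) ! i, (x # y # zs) ! Suc i} |i. Suc i < length (x # y # zs)}"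
    then obtain i where "e = {(x # y # zs) ! i, (x # y # zs) ! Suc i}" "Suc i < length (x # y # zs)" by auto
    then show "e \<in> insert {x, y} {{(y # zs) ! i, (y # zs) ! Suc i} |i. Suc i < length (y # zs)}"
      by (cases i) auto
  qed
qed auto

lemma path_edges_nthI: "Suc i < length xs \<Longrightarrow> {xs ! i, xs ! Suc i} \<in> path_edges xs"
  by (auto simp: path_edges_nth)

text \<open>Cut at \<open>u\<close> and \<open>v\<close>, the cycle falls into two paths: one
  through \<open>B\<close>, the other running backwards through \<open>A\<close>, over the closing
  edge and backwards through \<open>C\<close>.\<close>

lemma cycle_edges_split:
  "cycle_edges (A @ u # B @ v # C) = path_edges (u # B @ [v]) \<union> path_edges (u # rev A @ rev C @ [v])"
  by (cases "A = []"; cases "B = []"; cases "C = []")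
    (auto simp: cycle_edges_def path_edges_Cons path_edges_append last_rev hd_rev insert_commute)

lemma upath_rev: "upath E xs \<Longrightarrow> upath E (rev xs)"
  by (simp add: upath_def)

lemma ucycle_upaths:
  assumes "ucycle E (A @ u # B @ v # C)"
  shows "upath E (u # B @ [v])" "upath E (u # (rev A @ rev C) @ [v])"
  using assms unfolding ucycle_def upath_def cycle_edges_split by auto

text \<open>Translates the order of positions into the two sides of a cycle cut at
  \<open>xs ! i\<close> and \<open>xs ! j\<close>, the form in which
  \<open>cycle_edges_split\<close> applies.\<close>

lemma split_two_nth:
  assumes "i < j" "j < length xs"
  obtains A B C where "xs = A @ xs ! i # B @ xs ! j # C"
    "\<And>l. i < l \<Longrightarrow> l < j \<Longrightarrow> xs ! l \<in> set B"
    "\<And>l. l < i \<or> j < l \<and> l < length xs \<Longrightarrow> xs ! l \<in> set (A @ C)"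
proof
  let ?A = "take i xs" and ?B = "take (j - Suc i) (drop (Suc i) xs)" and ?C = "drop (Suc j) xs"
  have "drop (Suc i) xs = ?B @ drop j xs"
    using assms by (metis Suc_leI append_take_drop_id drop_drop le_add_diff_inverse2)
  then show "xs = ?A @ xs ! i # ?B @ xs ! j # ?C"
    using assms by (metis Cons_nth_drop_Suc append_take_drop_id less_trans)
  show "xs ! l \<in> set ?B" if "i < l" "l < j" for l
    unfolding in_set_conv_nth using assms that by (intro exI[of _ "l - Suc i"]) auto
  show "xs ! l \<in> set (?A @ ?C)" if "l < i \<or> j < l \<and> l < length xs" for l
  proof (cases "l < i")
    case True
    then have "xs ! l \<in> set ?A"
      unfolding in_set_conv_nth using assms by (intro exI[of _ l]) auto
    then show ?thesis by simp
  next
    case False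
    then have "xs ! l \<in> set ?C"
      unfolding in_set_conv_nth using assms that by (intro exI[of _ "l - Suc j"]) auto
    then show ?thesis by simp
  qed
qed

text \<open>By continuity \<open>g\<close> maps the closure of the open unit interval into the
  closure of its image. This carries information on the interior of a chord over to its
  ends.\<close>

lemma arc_subset_closure_endless:
  assumes "arc g"
  shows "path_image g \<subseteq> closure (path_image g - {pathstart g, pathfinish g})"
proof -
  have "path_image g - {pathstart g, pathfinish g} = g ` {0<..<1}"
    using assms by (simp add: arc_imp_simple_path simple_path_endless)
  moreover have "g ` closure {0<..<1} \<subseteq> closure (g ` {0<..<1})"
    using assms by (intro image_closure_subset) (auto simp: arc_def path_def closure_subset)
  ultimately show ?thesis by (simp add: path_image_def)
qed

section \<open>Topology of a fixed outerplanar drawing\<close>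

locale outerplanar_drawing =
  fixes V :: "'a set" and E :: "'a set set" and p :: "'a \<Rightarrow> complex" and c :: "'a set \<Rightarrow> real \<Rightarrow> complex"
  assumes simple: "simple_graph (V, E)"
    and drawing: "planar_drawing (V, E) p c"
    and outer: "p ` V \<subseteq> frontier (outside (drawing_image (V, E) p c))"
begin

abbreviation img :: "'a set set \<Rightarrow> complex set" where
  "img S \<equiv> \<Union>e\<in>S. path_image (c e)"

lemma edgeD:
  assumes "e \<in> E"
  shows "e \<subseteq> V" "card e = 2" "arc (c e)" "{pathstart (c e), pathfinish (c e)} = p ` e"
    "p ` e \<subseteq> path_image (c e)"
proof -
  show "e \<subseteq> V" "card e = 2" "arc (c e)" and 1: "{pathstart (c e), pathfinish (c e)} = p ` e"
    using simple drawing assms by (auto simp: simple_graph_def planar_drawing_def)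
  show "p ` e \<subseteq> path_image (c e)" unfolding 1[symmetric] by (simp add: pathstart_in_path_image pathfinish_in_path_image)
qed

lemma inj_p: "inj_on p V"
  using drawing by (simp add: planar_drawing_def)

lemma finite_E: "finite E"
  using simple finite_subset[of E "Pow V"] by (auto simp: simple_graph_def)

lemma closed_img: "S \<subseteq> E \<Longrightarrow> closed (img S)"
  using finite_E edgeD(3) by (intro closed_UN) (auto intro: finite_subset closed_path_image arc_imp_path)

lemma vertex_in_img: "S \<subseteq> E \<Longrightarrow> v \<in> V \<Longrightarrow> p v \<in> img S \<longleftrightarrow> v \<in> \<Union>S"
  using drawing edgeD(5) unfolding planar_drawing_def by fastforce

text \<open>Planarity puts a common point into the vertex images of two different edges; injectivity
  of \<open>p\<close> makes it the image of a common vertex.\<close>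

lemma img_Int_subset:
  assumes "S \<subseteq> E" "T \<subseteq> E" "S \<inter> T = {}"
  shows "img S \<inter> img T \<subseteq> p ` (\<Union>S \<inter> \<Union>T)"
proof
  fix z assume "z \<in> img S \<inter> img T"
  then obtain e f where ef: "e \<in> S" "f \<in> T" "z \<in> path_image (c e)" "z \<in> path_image (c f)" by auto
  then have "e \<noteq> f" "e \<in> E" "f \<in> E" using assms by auto
  then have "z \<in> p ` e \<inter> p ` f" using drawing ef unfolding planar_drawing_def by (metis IntI snd_conv subsetD)
  then obtain w w' where w: "w \<in> e" "w' \<in> f" "z = p w" "z = p w'" by auto
  then have "w = w'" using inj_onD[OF inj_p, of w w'] edgeD(1)[OF \<open>e \<in> E\<close>] edgeD(1)[OF \<open>f \<in> E\<close>] by auto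
  then show "z \<in> p ` (\<Union>S \<inter> \<Union>T)" using w ef by auto
qed

text \<open>This is where outerplanarity enters. Deleting edges enlarges the outside, so
  \<open>p v\<close> lies in the closure of \<open>outside (img S)\<close>. It is not on
  \<open>img S\<close>, and not in the inside either, which is open and disjoint from the
  outside.\<close>

lemma outer_vertex:
  assumes "S \<subseteq> E" "v \<in> V" "v \<notin> \<Union>S"
  shows "p v \<in> outside (img S)"
proof -
  have "img S \<subseteq> drawing_image (V, E) p c" using assms by (auto simp: drawing_image_def)
  then have "closure (outside (drawing_image (V, E) p c)) \<subseteq> closure (outside (img S))"
    by (intro closure_mono outside_mono)
  then have cl: "p v \<in> closure (outside (img S))" using outer assms(2) by (auto simp: frontier_def)
  have "p v \<notin> img S" using vertex_in_img assms by blast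
  moreover have "closure (outside (img S)) \<inter> inside (img S) = {}"
    using open_inside[OF closed_img[OF assms(1)]] by (metis Int_commute inside_Int_outside open_Int_closure_eq_empty)
  ultimately show ?thesis using cl inside_Un_outside[of "img S"] by blast
qed

lemma path_arc:
  assumes "upath E xs" "2 \<le> length xs"
  shows "\<exists>g. arc g \<and> pathstart g = p (hd xs) \<and> pathfinish g = p (last xs) \<and> path_image g = img (path_edges xs)"
  using assms
proof (induction xs rule: path_edges.induct)
  case (1 x y zs)
  have e: "{x, y} \<in> E" using 1 by (simp add: upath_def)
  have "x \<noteq> y" using 1 by (simp add: upath_def)
  have "p x \<noteq> p y" using \<open>x \<noteq> y\<close> inj_onD[OF inj_p, of x y] edgeD(1)[OF e] by auto
  obtain g where g: "arc g" "pathstart g = p x" "pathfinish g = p y" "path_image g = path_image (c {x, y})"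
  proof (cases "pathstart (c {x, y}) = p x")
    case True
    then show ?thesis using edgeD(3,4)[OF e] \<open>p x \<noteq> p y\<close> by (intro that[of "c {x, y}"]) (auto simp: doubleton_eq_iff)
  next
    case False
    then show ?thesis using edgeD(3,4)[OF e] \<open>p x \<noteq> p y\<close>
      by (intro that[of "reversepath (c {x, y})"]) (auto simp: doubleton_eq_iff arc_reversepath)
  qed
  show ?case
  proof (cases "zs = []")
    case True
    then show ?thesis using g by (intro exI[of _ g]) auto
  next
    case False
    then have len: "2 \<le> length (y # zs)" by (cases zs) auto
    have up: "upath E (y # zs)" "x \<notin> set (y # zs)" using 1 by (auto simp: upath_def)
    then obtain h where h: "arc h" "pathstart h = p y" "pathfinish h = p (last (y # zs))"
      "path_image h = img (path_edges (y # zs))"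
      using 1(1) len by auto
    have "path_image g \<inter> path_image h = img {{x, y}} \<inter> img (path_edges (y # zs))" using g h by simp
    also have "\<dots> \<subseteq> p ` (\<Union>{{x, y}} \<inter> \<Union>(path_edges (y # zs)))"
      using e up path_edges_subset[of "{x, y}" "y # zs"] by (intro img_Int_subset) (auto simp: upath_def)
    also have "\<dots> \<subseteq> {p y}" using up unfolding Union_path_edges[OF len] by auto
    finally have "arc (g +++ h)" using g h by (intro arc_join) auto
    then show ?thesis using g h by (intro exI[of _ "g +++ h"]) (auto simp: path_image_join)
  qed
qed auto

lemma upath_arc:
  assumes "upath E (a # P @ [b])"
  obtains g where "arc g" "pathstart g = p a" "pathfinish g = p b" "path_image g = img (path_edges (a # P @ [b]))"
  using path_arc[OF assms] by auto

lemma upath_subset_V: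
  assumes "upath E (a # P @ [b])" shows "set (a # P @ [b]) \<subseteq> V"
proof -
  have "set (a # P @ [b]) = \<Union>(path_edges (a # P @ [b]))" by (rule Union_path_edges[symmetric]) simp
  then show ?thesis using assms edgeD(1) by (auto simp: upath_def)
qed

text \<open>A common edge would have both ends in \<open>{a, b}\<close>, but the edge
  \<open>{a, b}\<close> is not on a path that has inner vertices. The two edge sets are thus
  disjoint, and \<open>img_Int_subset\<close> applies.\<close>

lemma img_paths_Int:
  assumes P: "upath E (a # P @ [b])" and Q: "upath E (a # Q @ [b])"
    and disj: "set P \<inter> set Q = {}" and ne: "P \<noteq> []"
  shows "img (path_edges (a # P @ [b])) \<inter> img (path_edges (a # Q @ [b])) = {p a, p b}"
proof -
  let ?P = "path_edges (a # P @ [b])" and ?Q = "path_edges (a # Q @ [b])"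
  have U: "\<Union>?P = set (a # P @ [b])" "\<Union>?Q = set (a # Q @ [b])" by (simp_all add: Union_path_edges)
  have sub: "?P \<subseteq> E" "?Q \<subseteq> E" using P Q by (auto simp: upath_def)
  have dist: "distinct (a # P @ [b])" using P by (simp add: upath_def)
  have "?P \<inter> ?Q = {}"
  proof (rule ccontr)
    assume "?P \<inter> ?Q \<noteq> {}"
    then obtain e where e: "e \<in> ?P" "e \<in> ?Q" by auto
    then have "e \<subseteq> {a, b}" using path_edges_subset[OF e(1)] path_edges_subset[OF e(2)] disj by auto
    moreover have "card e = 2" using e sub edgeD(2) by auto
    ultimately have "e = {a, b}" using dist card_subset_eq[of "{a, b}" e] by auto
    then have "{a, b} \<in> path_edges (a # P @ [b])" using e by simp
    moreover obtain x P' where "P = x # P'" using ne by (cases P) auto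
    ultimately show False using dist path_edges_subset[of "{a, b}" "x # P' @ [b]"]
      by (auto simp: doubleton_eq_iff)
  qed
  then have "img ?P \<inter> img ?Q \<subseteq> p ` (\<Union>?P \<inter> \<Union>?Q)" by (intro img_Int_subset sub)
  also have "\<dots> \<subseteq> {p a, p b}" unfolding U using disj by auto
  finally have "img ?P \<inter> img ?Q \<subseteq> {p a, p b}" .
  moreover have "p v \<in> img ?P" "p v \<in> img ?Q" if "v \<in> {a, b}" for v
    using that vertex_in_img[OF sub(1), of v] vertex_in_img[OF sub(2), of v] upath_subset_V[OF P] U by auto
  ultimately show ?thesis by blast
qed

text \<open>By \<open>outer_vertex\<close>, an inner vertex of the first path lies outside the other
  two, and likewise for the second path. These are the premises of \<open>theta_inside\<close>; the
  third path may be a single edge.\<close>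

lemma path_inside:
  assumes P: "upath E (a # P @ [b])" "P \<noteq> []" and Q: "upath E (a # Q @ [b])" "Q \<noteq> []"
    and R: "upath E (a # R @ [b])"
    and disj: "set P \<inter> set Q = {}" "set P \<inter> set R = {}" "set Q \<inter> set R = {}"
  shows "img (path_edges (a # R @ [b])) - {p a, p b}
    \<subseteq> inside (img (path_edges (a # P @ [b])) \<union> img (path_edges (a # Q @ [b])))"
proof -
  let ?P = "path_edges (a # P @ [b])" and ?Q = "path_edges (a # Q @ [b])" and ?R = "path_edges (a # R @ [b])"
  have U: "\<Union>?P = set (a # P @ [b])" "\<Union>?Q = set (a # Q @ [b])" "\<Union>?R = set (a # R @ [b])"
    by (simp_all add: Union_path_edges)
  have sub: "?P \<subseteq> E" "?Q \<subseteq> E" "?R \<subseteq> E" using P Q R by (auto simp: upath_def)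
  have dist: "distinct (a # P @ [b])" "distinct (a # Q @ [b])" using P Q by (auto simp: upath_def)
  obtain g1 where g1: "arc g1" "pathstart g1 = p a" "pathfinish g1 = p b" "path_image g1 = img ?P"
    using upath_arc[OF P(1)] .
  obtain g2 where g2: "arc g2" "pathstart g2 = p a" "pathfinish g2 = p b" "path_image g2 = img ?Q"
    using upath_arc[OF Q(1)] .
  obtain g3 where g3: "arc g3" "pathstart g3 = p a" "pathfinish g3 = p b" "path_image g3 = img ?R"
    using upath_arc[OF R(1)] .
  have out: "img S \<inter> outside (img T \<union> img T') \<noteq> {}"
    if "S \<subseteq> E" "T \<subseteq> E" "T' \<subseteq> E" "v \<in> \<Union>S" "v \<notin> \<Union>T" "v \<notin> \<Union>T'" for S T T' v
  proof -
    have "v \<in> V" using that(1,4) edgeD(1) by blast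
    then have "p v \<in> img S" using vertex_in_img[of S v] that by simp
    moreover have "p v \<in> outside (img (T \<union> T'))" using that \<open>v \<in> V\<close> by (intro outer_vertex) auto
    ultimately show ?thesis by (auto simp: UN_Un)
  qed
  have "hd P \<in> set P" "hd Q \<in> set Q" using P(2) Q(2) by simp_all
  then have hd: "hd P \<in> set P" "hd P \<notin> set Q" "hd P \<notin> set R" "hd Q \<in> set Q" "hd Q \<notin> set P" "hd Q \<notin> set R"
    using disj by blast+
  have out1: "img ?P \<inter> outside (img ?Q \<union> img ?R) \<noteq> {}"
    using sub hd dist by (intro out[where v = "hd P"]) (auto simp: U)
  have out2: "img ?Q \<inter> outside (img ?P \<union> img ?R) \<noteq> {}"
    using sub hd dist by (intro out[where v = "hd Q"]) (auto simp: U)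
  have "path_image g3 - {p a, p b} \<subseteq> inside (path_image g1 \<union> path_image g2)"
    by (rule theta_inside)
      (use g1 g2 g3 out1 out2 img_paths_Int[OF P(1) Q(1)] img_paths_Int[OF P(1) R] img_paths_Int[OF Q(1) R] disj P(2) Q(2) in simp_all)
  then show ?thesis using g1 g2 g3 by simp
qed

text \<open>An inner vertex of the third path would be inside the cycle of the other two by
  \<open>path_inside\<close>, and outside of it by \<open>outer_vertex\<close>.\<close>

lemma theta_free: "theta_free E"
  unfolding theta_free_def
proof (intro allI impI, elim conjE, rule ccontr)
  fix a b P Q R
  assume up: "upath E (a # P @ [b])" "upath E (a # Q @ [b])" "upath E (a # R @ [b])"
    and disj: "set P \<inter> set Q = {}" "set P \<inter> set R = {}" "set Q \<inter> set R = {}"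
    and "\<not> (P = [] \<or> Q = [] \<or> R = [])"
  then have ne: "P \<noteq> []" "Q \<noteq> []" "R \<noteq> []" by auto
  let ?P = "path_edges (a # P @ [b])" and ?Q = "path_edges (a # Q @ [b])" and ?R = "path_edges (a # R @ [b])"
  have sub: "?P \<subseteq> E" "?Q \<subseteq> E" "?R \<subseteq> E" using up by (auto simp: upath_def)
  let ?v = "hd R"
  have v: "?v \<in> set R" "?v \<in> V" using ne upath_subset_V[OF up(3)] by auto
  have "a \<in> V" "b \<in> V" using upath_subset_V[OF up(3)] by auto
  have dist: "?v \<noteq> a" "?v \<noteq> b" using up v by (auto simp: upath_def)
  then have "p ?v \<noteq> p a" "p ?v \<noteq> p b" using inj_onD[OF inj_p] v \<open>a \<in> V\<close> \<open>b \<in> V\<close> by blast+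
  moreover have "p ?v \<in> img ?R" using vertex_in_img[OF sub(3) v(2)] v by (simp add: Union_path_edges)
  ultimately have "p ?v \<in> inside (img ?P \<union> img ?Q)"
    using path_inside[OF up(1) ne(1) up(2) ne(2) up(3) disj] by blast
  moreover have "p ?v \<in> outside (img (?P \<union> ?Q))"
    using sub v disj dist by (intro outer_vertex) (auto simp: Union_path_edges)
  ultimately show False unfolding UN_Un using inside_Int_outside by blast
qed

text \<open>The case of \<open>path_inside\<close> where the third path is the chord and the other
  two are the sides of the cycle; both sides have inner vertices because \<open>B\<close> and
  \<open>A @ C\<close> are nonempty.\<close>

lemma chord_inside:
  assumes cyc: "ucycle E (A @ u # B @ v # C)" and "B \<noteq> []" "A @ C \<noteq> []" and e: "{u, v} \<in> E"
  shows "path_image (c {u, v}) - {p u, p v} \<subseteq> inside (img (cycle_edges (A @ u # B @ v # C)))"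
proof -
  have "distinct (A @ u # B @ v # C)" using cyc by (simp add: ucycle_def)
  then show ?thesis
    using path_inside[OF ucycle_upaths(1)[OF cyc] _ ucycle_upaths(2)[OF cyc], of "[]"] assms
    unfolding cycle_edges_split by (auto simp: upath_def UN_Un)
qed

text \<open>The chord \<open>{u, v}\<close> cuts the inside of the cycle into two regions. The other
  chord runs inside the cycle and avoids \<open>{u, v}\<close>, so by connectedness it stays in one
  region. But each region has one of \<open>x\<close> and \<open>y\<close> in the outside of its
  boundary curve.\<close>

lemma crossing_free: "crossing_free E"
  unfolding crossing_free_def
proof (intro allI impI, elim conjE, rule ccontr)
  fix xs i j l m
  assume cyc: "ucycle E xs" and ijlm: "i < j" "j < l" "l < m" "m < length xs"
    and "\<not> ({xs ! i, xs ! l} \<notin> E \<or> {xs ! j, xs ! m} \<notin> E)"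
  then have e1: "{xs ! i, xs ! l} \<in> E" and e2: "{xs ! j, xs ! m} \<in> E" by auto
  define u v x y where "u = xs ! i" and "v = xs ! l" and "x = xs ! j" and "y = xs ! m"
  have dist: "distinct xs" using cyc by (simp add: ucycle_def)
  have uvxy: "distinct [u, v, x, y]"
    using ijlm dist by (auto simp: u_def v_def x_def y_def nth_eq_iff_index_eq)
  let ?K = "img (cycle_edges xs)"
  obtain A B C where xs: "xs = A @ u # B @ v # C" and xy: "x \<in> set B" "y \<in> set (A @ C)"
    using split_two_nth[of i l xs] ijlm unfolding u_def v_def x_def y_def by (metis less_trans)
  obtain A' B' C' where xs': "xs = A' @ x # B' @ y # C'" and uv: "v \<in> set B'" "u \<in> set (A' @ C')"
    using split_two_nth[of j m xs] ijlm unfolding u_def v_def x_def y_def by (metis less_trans)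
  let ?Q = "rev A @ rev C"
  let ?P' = "path_edges (u # B @ [v])" and ?Q' = "path_edges (u # ?Q @ [v])"
  note up = ucycle_upaths[OF cyc[unfolded xs]]
  have sub: "?P' \<subseteq> E" "?Q' \<subseteq> E" using up by (auto simp: upath_def)
  have K: "?K = img ?P' \<union> img ?Q'" unfolding xs cycle_edges_split by (simp add: UN_Un)
  have uvE: "upath E (u # [] @ [v])" "{u, v} \<in> E" "{x, y} \<in> E" using e1 e2 uvxy by (auto simp: upath_def u_def v_def x_def y_def)
  have in1: "path_image (c {u, v}) - {p u, p v} \<subseteq> inside ?K"
    using chord_inside[of A u B v C] cyc xy uvE unfolding xs by fastforce
  have in2: "path_image (c {x, y}) - {p x, p y} \<subseteq> inside ?K"
    using chord_inside[of A' x B' y C'] cyc uv uvE unfolding xs' by fastforce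
  obtain g1 where g1: "arc g1" "pathstart g1 = p u" "pathfinish g1 = p v" "path_image g1 = img ?P'"
    using upath_arc[OF up(1)] .
  obtain g2 where g2: "arc g2" "pathstart g2 = p u" "pathfinish g2 = p v" "path_image g2 = img ?Q'"
    using upath_arc[OF up(2)] .
  obtain g3 where g3: "arc g3" "pathstart g3 = p u" "pathfinish g3 = p v" "path_image g3 = path_image (c {u, v})"
    using upath_arc[OF uvE(1)] by auto
  have V: "u \<in> V" "v \<in> V" "x \<in> V" "y \<in> V" using edgeD(1)[OF uvE(2)] edgeD(1)[OF uvE(3)] by auto
  have "p u \<noteq> p v" using arc_distinct_ends[OF g3(1)] g3 by auto
  have "B \<noteq> []" "?Q \<noteq> []" "set B \<inter> set ?Q = {}" using xy dist unfolding xs by auto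
  then have ints: "img ?P' \<inter> img ?Q' = {p u, p v}" "img ?P' \<inter> path_image (c {u, v}) = {p u, p v}"
      "img ?Q' \<inter> path_image (c {u, v}) = {p u, p v}"
    using img_paths_Int[OF up] img_paths_Int[OF up(1) uvE(1)] img_paths_Int[OF up(2) uvE(1)] by auto
  have ne: "path_image g3 \<inter> inside (path_image g1 \<union> path_image g2) \<noteq> {}"
    using in1 nonempty_simple_path_endless[OF arc_imp_simple_path[OF g3(1)]] g1 g2 g3 K by auto
  let ?S1 = "img (insert {u, v} ?P')" and ?S2 = "img (insert {u, v} ?Q')"
  have S: "?S1 = path_image g1 \<union> path_image g3" "?S2 = path_image g2 \<union> path_image g3"
    using g1 g2 g3 by auto
  obtain I: "inside ?S1 \<inter> inside ?S2 = {}" "inside ?S1 \<union> inside ?S2 \<union> (path_image (c {u, v}) - {p u, p v}) = inside ?K"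
    by (rule split_inside_simple_closed_curve[of g1 "p u" "p v" g2 g3])
      (use g1 g2 g3 ints ne \<open>p u \<noteq> p v\<close> K S in \<open>simp_all add: arc_imp_simple_path\<close>)
  let ?h = "path_image (c {x, y}) - {p x, p y}"
  have arch: "arc (c {x, y})" "{pathstart (c {x, y}), pathfinish (c {x, y})} = {p x, p y}"
    using edgeD(3,4)[OF uvE(3)] by auto
  have h: "connected ?h" "?h \<noteq> {}" "path_image (c {x, y}) \<subseteq> closure ?h"
    using connected_simple_path_endless[of "c {x, y}"] nonempty_simple_path_endless[of "c {x, y}"]
      arc_subset_closure_endless[of "c {x, y}"] arch by (simp_all add: arc_imp_simple_path)
  have "img {{u, v}} \<inter> img {{x, y}} \<subseteq> p ` (\<Union>{{u, v}} \<inter> \<Union>{{x, y}})"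
    using uvE uvxy by (intro img_Int_subset) (auto simp: doubleton_eq_iff)
  then have "?h \<inter> path_image (c {u, v}) = {}" using uvxy by auto
  then have hI: "?h \<subseteq> inside ?S1 \<union> inside ?S2" using in2 I(2) by blast
  have cl: "closed ?S1" "closed ?S2" using closed_img[of "insert {u, v} ?P'"] closed_img[of "insert {u, v} ?Q'"] sub uvE by auto
  then have op: "open (inside ?S1)" "open (inside ?S2)" by (simp_all only: open_inside)
  have disj: "inside ?S1 \<inter> ?h = {} \<or> inside ?S2 \<inter> ?h = {}"
    by (rule connectedD[OF h(1) op]) (use I(1) hI in blast)+
  \<comment> \<open>The ends of the chord are limits of its interior, so they lie in
    \<open>T \<union> inside T\<close> if the interior is inside \<open>T\<close>.\<close>
  have contra: "\<not> ?h \<subseteq> inside T" if "closed T" "w \<in> {x, y}" "p w \<in> outside T" for T w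
  proof
    assume "?h \<subseteq> inside T"
    then have "path_image (c {x, y}) \<subseteq> closure (inside T)" using h(3) closure_mono by blast
    also have "\<dots> \<subseteq> T \<union> inside T" using closure_inside_subset[OF \<open>closed T\<close>] by auto
    finally have "p w \<in> T \<union> inside T" using edgeD(5)[OF uvE(3)] that by auto
    then show False using that inside_Int_outside[of T] outside_no_overlap[of T] by blast
  qed
  have "p y \<in> outside ?S1"
    by (rule outer_vertex) (use sub uvE V xy uvxy dist in \<open>auto simp: Union_path_edges xs\<close>)
  moreover have "p x \<in> outside ?S2"
    by (rule outer_vertex) (use sub uvE V xy uvxy dist in \<open>auto simp: Union_path_edges xs\<close>)
  ultimately have "\<not> ?h \<subseteq> inside ?S1" "\<not> ?h \<subseteq> inside ?S2"
    using contra[OF cl(1), of y] contra[OF cl(2), of x] by auto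
  then show False using hI disj by blast
qed

end

section \<open>Counting noncrossing chords\<close>

text \<open>Here \<open>r\<close> counts the further edges of the face and \<open>T\<close> is the
  sum of their parameters, each at most \<open>k - 3\<close>; the third premise says this without
  subtraction. The values of \<alpha> and \<beta> are those giving equality in two cases:
  \<open>r = 2\<close> with \<open>t = T + 1\<close>, and \<open>r = k\<close> with
  \<open>t = 0\<close> and \<open>T = k * (k - 3)\<close>.\<close>

lemma chord_arith:
  fixes k r T :: nat and \<alpha> \<beta> :: int
  assumes "k \<ge> 3" "r \<ge> 2" "T + 3 * r \<le> r * k" "\<not> (r \<le> k - 1 \<and> k - 1 \<le> r + T)"
  defines "\<alpha> \<equiv> int k * (2 * int k - 5)" and "\<beta> \<equiv> (int k)\<^sup>2 - 2 * int k - 1"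
  shows "\<exists>t. t + 3 \<le> k \<and> (t = 0 \<or> t = Suc T \<and> r = 2) \<and>
    (int r - 1) * (\<alpha> - \<beta>) - (int k - 2) * int T - \<beta> \<ge> - (int k - 2) * int t"
proof -
  obtain m where m: "k = m + 3" using \<open>k \<ge> 3\<close> by (metis add.commute le_Suc_ex)
  obtain s where s: "r = s + 2" using \<open>r \<ge> 2\<close> by (metis add.commute le_Suc_ex)
  have T: "T \<le> (s + 2) * m" using assms(3) unfolding m s by (simp add: algebra_simps)
  \<comment> \<open>The excluded cycle length leaves \<open>r >= k\<close> or
    \<open>r + T <= k - 2\<close>.\<close>
  have c: "m < s \<or> s + T < m"
    using assms(4) unfolding m s by auto
  show ?thesis
  proof (cases "s = 0")
    case True
    then have "T < m" using c by simp
    then show ?thesis unfolding m s True \<alpha>_def \<beta>_def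
      by (intro exI[of _ "Suc T"]) (simp add: algebra_simps power2_eq_square)
  next
    case False
    have "int (s + 1) * (\<alpha> - \<beta>) - \<beta> \<ge> (int m + 1) * int T"
    proof (cases "m < s")
      case True
      then obtain q where q: "s = Suc (m + q)" using less_iff_Suc_add by blast
      have "(int m + 1) * int T \<le> (int m + 1) * ((int s + 2) * int m)"
        using T by (intro mult_left_mono) (auto simp flip: of_nat_mult of_nat_add simp: algebra_simps)
      \<comment> \<open>The difference of the two sides is \<open>(2 * m + 1) * q\<close>, zero
        exactly for \<open>r = k\<close>.\<close>
      also have "\<dots> \<le> int (s + 1) * (\<alpha> - \<beta>) - \<beta>"
        unfolding \<alpha>_def \<beta>_def m q by (simp add: algebra_simps power2_eq_square)
      finally show ?thesis .
    next
      case F: False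
      then obtain q where q: "m = Suc (s + T + q)" using c less_iff_Suc_add by blast
      obtain s' where s': "s = Suc s'" using False by (cases s) auto
      show ?thesis unfolding \<alpha>_def \<beta>_def m q s' by (simp add: algebra_simps power2_eq_square)
    qed
    then show ?thesis unfolding s m
      by (intro exI[of _ 0]) (simp add: algebra_simps)
  qed
qed

text \<open>
  Paths are powers of \<open>R\<close>, which only contains pairs \<open>(i, j)\<close> with \<open>i < j\<close>: monotone paths suffice.
  The inner face at \<open>(a, b)\<close> is traversed by always going to the largest neighbour.
\<close>

lemma noncrossing_chord_bound:
  fixes R :: "(nat \<times> nat) set" and k :: nat
  defines "\<alpha> \<equiv> int k * (2 * int k - 5)" and "\<beta> \<equiv> (int k)\<^sup>2 - 2 * int k - 1"
  assumes k: "k \<ge> 3"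
    and fin: "finite R"
    and less: "\<And>i j. (i, j) \<in> R \<Longrightarrow> i < j"
    and nocross: "\<And>x u y v. (x, y) \<in> R \<Longrightarrow> (u, v) \<in> R \<Longrightarrow> x < u \<Longrightarrow> u < y \<Longrightarrow> y < v \<Longrightarrow> False"
    and nocycle: "\<And>i j. (i, j) \<in> R \<Longrightarrow> (i, j) \<notin> R ^^ (k - 1)"
    and "(a, b) \<in> R"
    and "\<And>i. a \<le> i \<Longrightarrow> i < b \<Longrightarrow> (i, Suc i) \<in> R"
  shows "\<exists>t. t + 3 \<le> k \<and> (\<forall>j\<in>{1..t + 1}. (a, b) \<in> R ^^ j) \<and>
    \<alpha> - \<beta> - (int k - 2) * int t
      \<le> \<alpha> * (int b - int a) - \<beta> * int (card {(i, j) \<in> R. a \<le> i \<and> j \<le> b})"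
  using assms(8,9)
proof (induction "b - a" arbitrary: a b rule: less_induct)
  case less
  note ab = \<open>(a, b) \<in> R\<close>
  have "a < b" using assms(5) ab .
  have consec: "(i, Suc i) \<in> R" if "a \<le> i" "i < b" for i using less.prems that by blast
  let ?cnt = "\<lambda>a b. int (card {(i, j) \<in> R. a \<le> i \<and> j \<le> b})"
  define P where "P c d t \<longleftrightarrow> t + 3 \<le> k \<and> (\<forall>j\<in>{1..t + 1}. (c, d) \<in> R ^^ j) \<and>
    \<alpha> - \<beta> - (int k - 2) * int t \<le> \<alpha> * (int d - int c) - \<beta> * ?cnt c d" for c d t
  have IH: "\<exists>t. P c d t" if "(c, d) \<in> R" "a \<le> c" "d \<le> b" "(c, d) \<noteq> (a, b)" for c d
    unfolding P_def
  proof (rule less.hyps)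
    have "c < d" using assms(5) that by blast
    then show "d - c < b - a" using that by auto
  qed (use that less.prems in auto)
  \<comment> \<open>The analogue of \<open>P\<close> for a chain of \<open>r\<close> face edges from
    \<open>c\<close> to \<open>b\<close>: \<open>T\<close> adds up their parameters and
    \<open>e\<close> the numbers of edges below them.\<close>
  define Q where "Q c r T e \<longleftrightarrow> T + 3 * r \<le> r * k \<and> (\<forall>j\<in>{r..r + T}. (c, b) \<in> R ^^ j) \<and>
    int r * (\<alpha> - \<beta>) - (int k - 2) * int T \<le> \<alpha> * (int b - int c) - \<beta> * e" for c r T and e :: int
  have join: "Q c (Suc r) (t + T) (?cnt c d + e)" if P: "P c d t" and Q: "Q d r T e" for c d t r T e
  proof -
    have "(c, b) \<in> R ^^ j" if j: "j \<in> {Suc r..Suc r + (t + T)}" for j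
    proof -
      obtain j1 j2 where "j = j1 + j2" "j1 \<in> {1..t + 1}" "j2 \<in> {r..r + T}"
      proof (cases "j \<le> Suc r + t")
        case True
        then show ?thesis using j by (intro that[of "j - r" r]) auto
      next
        case False
        then show ?thesis using j by (intro that[of "t + 1" "j - (t + 1)"]) auto
      qed
      moreover have "(c, d) \<in> R ^^ j1" "(d, b) \<in> R ^^ j2"
        using P Q calculation unfolding P_def Q_def by blast+
      ultimately show ?thesis by (auto simp: relpow_add)
    qed
    then show ?thesis using P Q unfolding P_def Q_def by (auto simp: algebra_simps)
  qed
  \<comment> \<open>No edge passes over \<open>d\<close>: one starting at \<open>c\<close> would
    contradict the maximality of \<open>d\<close>, one starting between \<open>c\<close> and
    \<open>d\<close> would cross \<open>(c, d)\<close>. The condition on \<open>c = a\<close>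
    removes the chord \<open>(a, b)\<close> itself, so that the statement serves both the first step
    of the face walk and the later ones.\<close>
  have split: "card {(i, j) \<in> R. c \<le> i \<and> j \<le> b \<and> (c = a \<longrightarrow> (i, j) \<noteq> (a, b))}
      = card {(i, j) \<in> R. c \<le> i \<and> j \<le> d} + card {(i, j) \<in> R. d \<le> i \<and> j \<le> b}"
    if "(c, d) \<in> R" "a \<le> c" "d \<le> b" "(c, d) \<noteq> (a, b)"
      and max: "\<And>d'. (c, d') \<in> R \<Longrightarrow> d' \<le> b \<Longrightarrow> (c, d') \<noteq> (a, b) \<Longrightarrow> d' \<le> d" for c d
  proof -
    have "c < d" using assms(5) that by blast
    have "{(i, j) \<in> R. c \<le> i \<and> j \<le> b \<and> (c = a \<longrightarrow> (i, j) \<noteq> (a, b))}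
      = {(i, j) \<in> R. c \<le> i \<and> j \<le> d} \<union> {(i, j) \<in> R. d \<le> i \<and> j \<le> b}" (is "?L = ?A \<union> ?B")
    proof (intro subset_antisym subsetI)
      fix p assume "p \<in> ?L"
      then obtain i j where p: "p = (i, j)" "(i, j) \<in> R" "c \<le> i" "j \<le> b" "c = a \<longrightarrow> (i, j) \<noteq> (a, b)" by auto
      show "p \<in> ?A \<union> ?B"
      proof (cases "i = c")
        case True
        then show ?thesis using p max[of j] by auto
      next
        case False
        then have "\<not> (i < d \<and> d < j)" using p assms(6)[OF \<open>(c, d) \<in> R\<close> p(2)] by auto
        then show ?thesis using p by auto
      qed
    next
      fix p assume "p \<in> ?A \<union> ?B"
      then show "p \<in> ?L" using that \<open>c < d\<close> by auto
    qed
    moreover have "?A \<inter> ?B = {}" using assms(5) by force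
    moreover have "finite ?A" "finite ?B" using fin by (auto intro: finite_subset)
    ultimately show ?thesis by (simp add: card_Un_disjoint)
  qed
  have maxnb: "\<exists>d. (c, d) \<in> R \<and> d \<le> b \<and> (c, d) \<noteq> (a, b) \<and>
      (\<forall>d'. (c, d') \<in> R \<longrightarrow> d' \<le> b \<longrightarrow> (c, d') \<noteq> (a, b) \<longrightarrow> d' \<le> d)"
    if "a \<le> c" "c < b" "(c, Suc c) \<noteq> (a, b)" for c
  proof -
    let ?D = "{d. (c, d) \<in> R \<and> d \<le> b \<and> (c, d) \<noteq> (a, b)}"
    have "finite ?D" by (rule finite_subset[of _ "{..b}"]) auto
    moreover have "Suc c \<in> ?D" using that consec[of c] by auto
    ultimately show ?thesis using Max_in[of ?D] Max_ge[of ?D] by (intro exI[of _ "Max ?D"]) blast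
  qed
  \<comment> \<open>The face walk from \<open>c\<close> to \<open>b\<close>. Starting after
    \<open>a\<close>, it never meets the chord \<open>(a, b)\<close>.\<close>
  have chain: "\<exists>r T. r \<ge> 1 \<and> Q c r T (?cnt c b)" if "a < c" "c < b" for c
    using that
  proof (induction "b - c" arbitrary: c rule: less_induct)
    case (less c)
    obtain d where d: "(c, d) \<in> R" "d \<le> b" "(c, d) \<noteq> (a, b)"
      "\<And>d'. (c, d') \<in> R \<Longrightarrow> d' \<le> b \<Longrightarrow> (c, d') \<noteq> (a, b) \<Longrightarrow> d' \<le> d"
      using maxnb[of c] less.prems by auto
    obtain t where t: "P c d t" using IH[of c d] d less.prems by auto
    show ?case
    proof (cases "d = b")
      case True
      then show ?thesis using t unfolding P_def Q_def by (intro exI[of _ 1] exI[of _ t]) auto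
    next
      case False
      have "c < d" using assms(5) d by blast
      then have "b - d < b - c" "a < d" "d < b" using d(2) False less.prems by auto
      then obtain r T where "r \<ge> 1" "Q d r T (?cnt d b)" using less.hyps[of d] less.prems d False by auto
      then have "Q c (Suc r) (t + T) (?cnt c d + ?cnt d b)" using join t by blast
      moreover have "?cnt c d + ?cnt d b = ?cnt c b"
        using split[of c d] d less.prems by auto
      ultimately have "Q c (Suc r) (t + T) (?cnt c b)" by simp
      then show ?thesis by (intro exI[of _ "Suc r"] exI[of _ "t + T"]) simp
    qed
  qed
  show ?case
  proof (cases "b = Suc a")
    case True
    have "{(i, j) \<in> R. a \<le> i \<and> j \<le> b} = {(a, b)}" using assms(5) ab True by force
    then show ?thesis using k ab True by (intro exI[of _ 0]) auto
  next
    case False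
    obtain d where d: "(a, d) \<in> R" "d \<le> b" "(a, d) \<noteq> (a, b)"
      "\<And>d'. (a, d') \<in> R \<Longrightarrow> d' \<le> b \<Longrightarrow> (a, d') \<noteq> (a, b) \<Longrightarrow> d' \<le> d"
      using maxnb[of a] False \<open>a < b\<close> by auto
    have "a < d" using assms(5) d by blast
    have "d < b" using d by auto
    obtain t where t: "P a d t" using IH[of a d] d by auto
    obtain r T where r: "r \<ge> 1" "Q d r T (?cnt d b)" using chain[of d] \<open>a < d\<close> \<open>d < b\<close> by auto
    let ?r = "Suc r" and ?T = "t + T"
    have Q: "Q a ?r ?T (?cnt a d + ?cnt d b)" using join t r by blast
    have "{(i, j) \<in> R. a \<le> i \<and> j \<le> b} = insert (a, b) {(i, j) \<in> R. a \<le> i \<and> j \<le> b \<and> (a = a \<longrightarrow> (i, j) \<noteq> (a, b))}"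
      using ab by auto
    moreover have "finite {(i, j) \<in> R. a \<le> i \<and> j \<le> b \<and> (a = a \<longrightarrow> (i, j) \<noteq> (a, b))}"
      by (rule finite_subset[OF _ fin]) auto
    ultimately have cnt: "?cnt a b = 1 + ?cnt a d + ?cnt d b"
      using split[of a d] d by simp
    \<comment> \<open>A path of length \<open>k - 1\<close> from \<open>a\<close> to
      \<open>b\<close> would close up with the chord to a \<open>k\<close>-cycle, and all lengths
      from \<open>?r\<close> to \<open>?r + ?T\<close> occur.\<close>
    have "\<not> (?r \<le> k - 1 \<and> k - 1 \<le> ?r + ?T)"
      using Q nocycle[OF ab] unfolding Q_def by auto
    then obtain t' where t': "t' + 3 \<le> k" "t' = 0 \<or> t' = Suc ?T \<and> ?r = 2"
      "(int ?r - 1) * (\<alpha> - \<beta>) - (int k - 2) * int ?T - \<beta> \<ge> - (int k - 2) * int t'"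
      using chord_arith[of k ?r ?T] k r(1) Q unfolding Q_def \<alpha>_def \<beta>_def by auto
    \<comment> \<open>Length 1 is the chord itself; if \<open>t' = Suc ?T\<close>, the two-edge
      chain supplies the lengths from 2 to \<open>?T + 2\<close>.\<close>
    have "(a, b) \<in> R ^^ j" if "j \<in> {1..t' + 1}" for j
    proof (cases "j = 1")
      case True
      then show ?thesis using ab by simp
    next
      case False
      then show ?thesis using that t'(2) Q unfolding Q_def by auto
    qed
    moreover have "\<alpha> - \<beta> - (int k - 2) * int t' \<le> \<alpha> * (int b - int a) - \<beta> * ?cnt a b"
      using Q t'(3) unfolding Q_def cnt by (simp add: algebra_simps)
    ultimately show ?thesis using t'(1) by blast
  qed
qed

section \<open>Reduction to Hamiltonian graphs\<close>

text \<open>The ear and the two sides of the cycle are three disjoint paths, so one side is a single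
  edge, and the ear can replace that edge.\<close>

lemma ear_extends_cycle:
  assumes cyc: "ucycle E (A @ u # B @ v # C)" and "theta_free E"
    and D: "D \<noteq> []" "upath E (u # D @ [v])" "set D \<inter> set (A @ u # B @ v # C) = {}"
  shows "\<exists>ys. ucycle E ys \<and> length (A @ u # B @ v # C) < length ys"
proof -
  note up = ucycle_upaths[OF cyc]
  have dist: "distinct (A @ u # B @ v # C)" "distinct (u # D @ [v])" using cyc D by (simp_all add: ucycle_def upath_def)
  have "set B \<inter> set D = {}" "set B \<inter> set (rev A @ rev C) = {}" "set D \<inter> set (rev A @ rev C) = {}"
    using dist(1) D(3) by auto
  then have "B = [] \<or> D = [] \<or> rev A @ rev C = []"
    using \<open>theta_free E\<close> up D(2) unfolding theta_free_def by presburger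
  then consider "B = []" | "rev A @ rev C = []" using D(1) by auto
  then show ?thesis
  proof cases
    case 1
    have "ucycle E (A @ u # D @ v # C)"
      using up D dist unfolding ucycle_def cycle_edges_split by (auto simp: upath_def)
    then show ?thesis using 1 D by (intro exI[of _ "A @ u # D @ v # C"]) auto
  next
    case 2
    have "ucycle E ([] @ u # D @ v # rev B)"
      using up D dist unfolding ucycle_def cycle_edges_split by (auto simp: upath_def)
    then show ?thesis using 2 D by (intro exI[of _ "u # D @ v # rev B"]) auto
  qed
qed

lemma rtrancl_imp_upath:
  assumes "(s, t) \<in> r\<^sup>*" and "\<And>x y. (x, y) \<in> r \<Longrightarrow> {x, y} \<in> E \<and> y \<in> S" and "s \<in> S"
  shows "\<exists>D. D \<noteq> [] \<and> hd D = s \<and> last D = t \<and> upath E D \<and> set D \<subseteq> S"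
  using assms(1)
proof (induction rule: rtrancl_induct)
  case base
  then show ?case using \<open>s \<in> S\<close> by (intro exI[of _ "[s]"]) (auto simp: upath_def)
next
  case (step y z)
  then obtain D where D: "D \<noteq> []" "hd D = s" "last D = y" "upath E D" "set D \<subseteq> S" by blast
  have yz: "{y, z} \<in> E" "z \<in> S" using assms(2) step by auto
  show ?case
  proof (cases "z \<in> set D")
    case True
    \<comment> \<open>The walk returns to a vertex of the path, which is cut off there.\<close>
    then obtain xs ys where "D = xs @ z # ys" by (meson split_list)
    then have "D = (xs @ [z]) @ ys" by simp
    then show ?thesis using D by (intro exI[of _ "xs @ [z]"]) (auto simp: upath_def path_edges_append hd_append split: if_splits)
  next
    case False
    then show ?thesis using D yz by (intro exI[of _ "D @ [z]"]) (auto simp: upath_def path_edges_append)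
  qed
qed

text \<open>Take a longest cycle. If it misses a vertex \<open>w\<close>, let \<open>S\<close> be
  the component of \<open>w\<close> off the cycle. Two attachments of \<open>S\<close> to the cycle
  would yield an ear and a longer cycle, so at most one cycle vertex \<open>a\<close> is adjacent to
  \<open>S\<close>, and \<open>a\<close> separates \<open>S\<close> from the rest.\<close>

lemma hamiltonian_cycle:
  assumes simple: "simple_graph (V, E)" and "E \<noteq> {}" and "theta_free E"
    and nonsep: "\<not> (\<exists>V1 V2 a. V1 \<union> V2 = V \<and> V1 \<inter> V2 = {a} \<and> 2 \<le> card V1 \<and> 2 \<le> card V2 \<and> (\<forall>e\<in>E. e \<subseteq> V1 \<or> e \<subseteq> V2))"
  shows "\<exists>xs. ucycle E xs \<and> set xs = V"
proof -
  have fin: "finite V" and E: "e \<in> E \<Longrightarrow> e \<subseteq> V \<and> card e = 2" for e using simple by (auto simp: simple_graph_def)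
  have cyc_V: "set xs \<subseteq> V" if "ucycle E xs" for xs
  proof -
    have "set xs = \<Union>(path_edges xs)" using that by (simp add: Union_path_edges ucycle_def)
    then show ?thesis using that E by (auto simp: ucycle_def cycle_edges_def)
  qed
  obtain e where "e \<in> E" using \<open>E \<noteq> {}\<close> by auto
  then obtain u v where "e = {u, v}" "u \<noteq> v" using E by (metis card_2_iff)
  then have "ucycle E [u, v]" using \<open>e \<in> E\<close> by (auto simp: ucycle_def cycle_edges_def insert_commute)
  moreover have "length xs \<le> card V" if "ucycle E xs" for xs
    using cyc_V[OF that] that card_mono[OF fin] by (metis distinct_card ucycle_def)
  ultimately obtain xs where xs: "ucycle E xs" and max: "\<And>ys. ucycle E ys \<Longrightarrow> length ys \<le> length xs"
    using ex_has_greatest_nat[of "ucycle E" "[u, v]" length "Suc (card V)"] by (auto simp: less_Suc_eq_le)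
  have "set xs = V"
  proof (rule ccontr)
    assume "set xs \<noteq> V"
    then obtain w where w: "w \<in> V" "w \<notin> set xs" using cyc_V xs by auto
    define r where "r = {(x, y). {x, y} \<in> E \<and> x \<notin> set xs \<and> y \<notin> set xs}"
    define S where "S = {y. (w, y) \<in> r\<^sup>*}"
    have "sym r" by (auto simp: r_def sym_def insert_commute)
    have SV: "S \<subseteq> V - set xs"
    proof
      fix y assume "y \<in> S"
      then have "(w, y) \<in> r\<^sup>*" by (simp add: S_def)
      then show "y \<in> V - set xs"
        by (induction rule: rtrancl_induct) (use w E in \<open>auto simp: r_def\<close>)
    qed
    have Sstep: "y \<in> S" if "x \<in> S" "{x, y} \<in> E" "y \<notin> set xs" for x y
      using that SV rtrancl_into_rtrancl[of w x r y] by (auto simp: S_def r_def)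
    have "w \<in> S" by (simp add: S_def)
    define N where "N = {a \<in> set xs. \<exists>s\<in>S. {s, a} \<in> E}"
    have "a = b" if ab: "a \<in> N" "b \<in> N" for a b
    proof (rule ccontr)
      assume "a \<noteq> b"
      obtain s t where st: "s \<in> S" "{s, a} \<in> E" "t \<in> S" "{t, b} \<in> E" using ab by (auto simp: N_def)
      have "(s, w) \<in> r\<^sup>*" "(w, t) \<in> r\<^sup>*" using st sym_rtrancl[OF \<open>sym r\<close>] by (auto simp: S_def dest: symD)
      then have "(s, t) \<in> r\<^sup>*" by auto
      then obtain D where D: "D \<noteq> []" "hd D = s" "last D = t" "upath E D" "set D \<subseteq> - set xs"
        using rtrancl_imp_upath[of s t r E "- set xs"] st SV unfolding r_def by blast
      have "a \<in> set xs" "b \<in> set xs" using ab by (auto simp: N_def)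
      then have up: "upath E (a # D @ [b])" using D st \<open>a \<noteq> b\<close>
        by (auto simp: upath_def path_edges_Cons path_edges_append insert_commute)
      then have up': "upath E (b # rev D @ [a])" using upath_rev by fastforce
      obtain ys zs where yz: "xs = ys @ a # zs" using split_list[OF \<open>a \<in> set xs\<close>] by auto
      then consider "b \<in> set ys" | "b \<in> set zs" using \<open>a \<noteq> b\<close> \<open>b \<in> set xs\<close> by auto
      then have "\<exists>ys. ucycle E ys \<and> length xs < length ys"
      proof cases
        case 1
        then obtain A B where "xs = A @ b # B @ a # zs" using yz by (auto dest: split_list)
        then show ?thesis using ear_extends_cycle[of E A b B a zs "rev D"] xs \<open>theta_free E\<close> D up' by auto
      next
        case 2
        then obtain A B where "xs = ys @ a # A @ b # B" using yz by (auto dest: split_list)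
        then show ?thesis using ear_extends_cycle[of E ys a A b B D] xs \<open>theta_free E\<close> D up by auto
      qed
      then show False using max by fastforce
    qed
    moreover have two: "2 \<le> card (set xs)" using xs by (simp add: ucycle_def distinct_card)
    ultimately obtain a where a: "a \<in> set xs" "N \<subseteq> {a}"
    proof (cases "N = {}")
      \<comment> \<open>If \<open>S\<close> has no attachment at all, any vertex of the cycle can
        serve as \<open>a\<close>.\<close>
      case True
      obtain a where "a \<in> set xs" using two by (cases xs) auto
      then show ?thesis using that True by auto
    next
      case False
      then obtain a where "a \<in> N" by auto
      then show ?thesis using that[of a] \<open>\<And>b a. a \<in> N \<Longrightarrow> b \<in> N \<Longrightarrow> a = b\<close> by (auto simp: N_def)
    qed
    let ?V1 = "insert a S" and ?V2 = "V - S"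
    have "a \<in> V" "a \<notin> S" using a cyc_V[OF xs] SV by auto
    have "finite S" using SV fin finite_subset by blast
    have "?V1 \<union> ?V2 = V" "?V1 \<inter> ?V2 = {a}" using SV \<open>a \<in> V\<close> \<open>a \<notin> S\<close> by auto
    moreover have "2 \<le> card ?V1"
      using \<open>w \<in> S\<close> \<open>a \<notin> S\<close> \<open>finite S\<close> by (simp add: Suc_le_eq card_gt_0_iff) blast
    moreover have "2 \<le> card ?V2"
      proof -
      have "set xs \<subseteq> ?V2" using cyc_V[OF xs] SV by blast
      then show ?thesis using two card_mono[of ?V2 "set xs"] fin by simp
    qed
    moreover have "e \<subseteq> ?V1 \<or> e \<subseteq> ?V2" if "e \<in> E" for e
    proof (cases "e \<inter> S = {}")
      case True
      then show ?thesis using E that by auto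
    next
      case False
      then obtain x where x: "x \<in> e" "x \<in> S" by auto
      moreover obtain y z where "e = {y, z}" using E[OF \<open>e \<in> E\<close>] by (auto simp: card_2_iff)
      ultimately have "e = {x, if x = y then z else y}" by auto
      then obtain y where e: "e = {x, y}" "x \<in> S" using x by blast
      then have "y \<in> S \<or> y \<in> N" using Sstep[of x y] that by (auto simp: N_def)
      then show ?thesis using e a by auto
    qed
    ultimately have "?V1 \<union> ?V2 = V \<and> ?V1 \<inter> ?V2 = {a} \<and> 2 \<le> card ?V1 \<and> 2 \<le> card ?V2 \<and>
        (\<forall>e\<in>E. e \<subseteq> ?V1 \<or> e \<subseteq> ?V2)"
      by (intro conjI ballI)
    then have "\<exists>V1 V2 a. V1 \<union> V2 = V \<and> V1 \<inter> V2 = {a} \<and> 2 \<le> card V1 \<and> 2 \<le> card V2 \<and>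
        (\<forall>e\<in>E. e \<subseteq> V1 \<or> e \<subseteq> V2)"
      by (intro exI)
    with nonsep show False by (rule notE)
  qed
  then show ?thesis using xs by blast
qed

text \<open>With the vertices numbered along the cycle, the closing edge becomes the chord
  \<open>(0, n - 1)\<close>, which spans all edges, so \<open>noncrossing_chord_bound\<close> counts
  all of \<open>E\<close>.\<close>

lemma hamiltonian_edge_bound:
  fixes k :: nat
  assumes k: "k \<ge> 3" and simple: "simple_graph (V, E)" and "crossing_free E"
    and nocycle: "\<And>xs. ucycle E xs \<Longrightarrow> length xs \<noteq> k"
    and cyc: "ucycle E xs" "set xs = V"
  shows "((int k)\<^sup>2 - 2 * int k - 1) * int (card E) \<le> (2 * int k - 5) * (int k * int (card V) - int k - 1)"
proof -
  have E: "e \<in> E \<Longrightarrow> e \<subseteq> V \<and> card e = 2" for e using simple by (auto simp: simple_graph_def)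
  have dist: "distinct xs" and len: "2 \<le> length xs" and cE: "cycle_edges xs \<subseteq> E" using cyc by (auto simp: ucycle_def)
  let ?n = "length xs"
  have n: "card V = ?n" using dist cyc distinct_card by metis
  define R where "R = {(i, j). i < j \<and> j < ?n \<and> {xs ! i, xs ! j} \<in> E}"
  have finR: "finite R" by (rule finite_subset[of _ "{..<?n} \<times> {..<?n}"]) (auto simp: R_def)
  have ham: "(i, Suc i) \<in> R" if "i < ?n - 1" for i
    using that cE path_edges_nthI[of i xs] by (auto simp: R_def cycle_edges_def)
  have root: "(0, ?n - 1) \<in> R"
  proof -
    have "xs \<noteq> []" using len by auto
    then show ?thesis using cE len by (auto simp: R_def cycle_edges_def last_conv_nth hd_conv_nth insert_commute)
  qed
  have nocyc: "(i, j) \<notin> R ^^ (k - 1)" if ij: "(i, j) \<in> R" for i j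
  proof
    assume "(i, j) \<in> R ^^ (k - 1)"
    then obtain f where f: "f 0 = i" "f (k - 1) = j" "\<And>l. l < k - 1 \<Longrightarrow> (f l, f (Suc l)) \<in> R"
      by (auto simp: relpow_fun_conv)
    let ?f = "map (\<lambda>l. xs ! f l) [0..<k]"
    \<comment> \<open>All steps of \<open>R\<close> go upwards, so the vertices of the path are
      distinct and it closes up with the edge \<open>(i, j)\<close> to a cycle of length
      \<open>k\<close>.\<close>
    have mono: "f l < f m" if "l < m" "m < k" for l m
      using that
    proof (induction m)
      case (Suc m)
      then have "f m < f (Suc m)" using f(3)[of m] by (auto simp: R_def)
      then show ?case using Suc by (cases "l = m") auto
    qed simp
    have bound: "f l < ?n" if "l < k" for l
      proof -
      have "l = k - 1 \<or> l < k - 1" using that by linarith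
      then have "f l \<le> f (k - 1)" using mono[of l "k - 1"] k by auto
      then show ?thesis using f(2) ij by (auto simp: R_def)
    qed
    have "inj_on (\<lambda>l. xs ! f l) {0..<k}"
    proof (rule inj_onI)
      fix l m assume lm: "l \<in> {0..<k}" "m \<in> {0..<k}" "xs ! f l = xs ! f m"
      then have "f l = f m" using dist bound by (simp add: nth_eq_iff_index_eq)
      then show "l = m" using mono[of l m] mono[of m l] lm by (cases l m rule: linorder_cases) auto
    qed
    then have "distinct ?f" by (simp add: distinct_map)
    moreover have "path_edges ?f \<subseteq> E"
      using f(3) by (auto simp: path_edges_nth R_def)
    moreover have "{last ?f, hd ?f} \<in> E"
      using k f(1,2) ij by (auto simp: last_map hd_map R_def insert_commute)
    ultimately have "ucycle E ?f" using k by (simp add: ucycle_def cycle_edges_def)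
    then show False using nocycle by fastforce
  qed
  have nocross: False if "(x, y) \<in> R" "(u, v) \<in> R" "x < u" "u < y" "y < v" for x u y v
    using \<open>crossing_free E\<close> cyc(1) that unfolding crossing_free_def R_def by blast
  have "bij_betw (\<lambda>(i, j). {xs ! i, xs ! j}) R E"
    unfolding bij_betw_def
  proof
    show "inj_on (\<lambda>(i, j). {xs ! i, xs ! j}) R"
      using dist by (auto simp: inj_on_def R_def doubleton_eq_iff nth_eq_iff_index_eq)
    show "(\<lambda>(i, j). {xs ! i, xs ! j}) ` R = E"
    proof (intro subset_antisym subsetI)
      fix e assume "e \<in> E"
      then obtain x y where e: "e = {x, y}" "x \<noteq> y" "x \<in> set xs" "y \<in> set xs"
        using E[of e] cyc(2) by (auto simp: card_2_iff)
      then obtain i j where ij: "i < ?n" "j < ?n" "x = xs ! i" "y = xs ! j" by (metis in_set_conv_nth)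
      then have "(i, j) \<in> R \<or> (j, i) \<in> R" using e \<open>e \<in> E\<close> by (cases i j rule: linorder_cases) (auto simp: R_def insert_commute)
      then show "e \<in> (\<lambda>(i, j). {xs ! i, xs ! j}) ` R" using e ij by (auto simp: image_iff insert_commute)
    qed (auto simp: R_def)
  qed
  then have "card R = card E" by (rule bij_betw_same_card)
  moreover have "{(i, j) \<in> R. 0 \<le> i \<and> j \<le> ?n - 1} = R" by (auto simp: R_def)
  ultimately have card_R: "card {(i, j) \<in> R. 0 \<le> i \<and> j \<le> ?n - 1} = card E" by (simp only:)
  have "\<exists>t. t + 3 \<le> k \<and> (\<forall>j\<in>{1..t + 1}. (0, ?n - 1) \<in> R ^^ j) \<and>
    int k * (2 * int k - 5) - ((int k)\<^sup>2 - 2 * int k - 1) - (int k - 2) * int t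
      \<le> int k * (2 * int k - 5) * (int (?n - 1) - int 0)
        - ((int k)\<^sup>2 - 2 * int k - 1) * int (card {(i, j) \<in> R. 0 \<le> i \<and> j \<le> ?n - 1})"
  proof (rule noncrossing_chord_bound[OF k finR _ _ nocyc root])
    show "i < j" if "(i, j) \<in> R" for i j using that by (simp add: R_def)
    show False if "(x, y) \<in> R" "(u, v) \<in> R" "x < u" "u < y" "y < v" for x u y v
      by (rule nocross[OF that])
    show "(i, Suc i) \<in> R" if "i < ?n - 1" for i by (rule ham[OF that])
  qed
  then obtain t where t: "t + 3 \<le> k"
    "int k * (2 * int k - 5) - ((int k)\<^sup>2 - 2 * int k - 1) - (int k - 2) * int t
      \<le> int k * (2 * int k - 5) * (int (?n - 1) - int 0) - ((int k)\<^sup>2 - 2 * int k - 1) * int (card E)"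
    unfolding card_R by (elim exE conjE)
  \<comment> \<open>With \<open>t\<close> at most \<open>k - 3\<close>, the constant \<alpha> -
    \<beta> - (k - 2) t is at least \<open>2 * k - 5\<close>, which is a factor of \<alpha>
    too.\<close>
  have "(int k - 2) * int t \<le> (int k - 2) * (int k - 3)" using t(1) k by (intro mult_left_mono) auto
  moreover have "int (?n - 1) = int ?n - 1" using len by auto
  ultimately show ?thesis using t(2) unfolding n by (simp add: algebra_simps power2_eq_square)
qed

section \<open>Induction over cut vertices\<close>

lemma upath_mono: "upath E xs \<Longrightarrow> E \<subseteq> F \<Longrightarrow> upath F xs"
  and ucycle_mono: "ucycle E xs \<Longrightarrow> E \<subseteq> F \<Longrightarrow> ucycle F xs"
  by (auto simp: upath_def ucycle_def)

text \<open>At a cut vertex the two sides have \<open>card V + 1\<close> vertices in total, and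
  their bounds add up to \<open>2 * k - 5\<close> less than the bound for \<open>V\<close>. Without
  a cut vertex the graph is edgeless or Hamiltonian.\<close>

lemma edge_bound:
  fixes k :: nat
  assumes k: "k \<ge> 3" and "simple_graph (V, E)" "theta_free E" "crossing_free E"
    and "\<And>xs. ucycle E xs \<Longrightarrow> length xs \<noteq> k" and "2 \<le> card V"
  shows "((int k)\<^sup>2 - 2 * int k - 1) * int (card E) \<le> (2 * int k - 5) * (int k * int (card V) - int k - 1)"
  using assms(2-)
proof (induction "card V" arbitrary: V E rule: less_induct)
  case less
  have fin: "finite V" and E: "e \<in> E \<Longrightarrow> e \<subseteq> V \<and> card e = 2" for e
    using less.prems by (auto simp: simple_graph_def)
  have "E \<subseteq> Pow V" using E by auto
  then have finE: "finite E" using fin by (simp add: finite_subset)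
  show ?case
  proof (cases "\<exists>V1 V2 a. V1 \<union> V2 = V \<and> V1 \<inter> V2 = {a} \<and> 2 \<le> card V1 \<and> 2 \<le> card V2 \<and> (\<forall>e\<in>E. e \<subseteq> V1 \<or> e \<subseteq> V2)")
    case True
    then obtain V1 V2 a where *: "V1 \<union> V2 = V \<and> V1 \<inter> V2 = {a} \<and> 2 \<le> card V1 \<and> 2 \<le> card V2 \<and>
        (\<forall>e\<in>E. e \<subseteq> V1 \<or> e \<subseteq> V2)"
      by (elim exE)
    then have V: "V1 \<union> V2 = V" "V1 \<inter> V2 = {a}" "2 \<le> card V1" "2 \<le> card V2"
      by simp_all
    have sep: "e \<subseteq> V1 \<or> e \<subseteq> V2" if "e \<in> E" for e using * that by simp
    have "finite V1" "finite V2" using V fin by auto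
    then have cV: "card V1 + card V2 = card V + 1" using V card_Un_Int[of V1 V2] by simp
    let ?E = "\<lambda>W. {e \<in> E. e \<subseteq> W}"
    have part: "((int k)\<^sup>2 - 2 * int k - 1) * int (card (?E W)) \<le> (2 * int k - 5) * (int k * int (card W) - int k - 1)"
      if W: "W \<subseteq> V" "card W < card V" "2 \<le> card W" for W
    proof (rule less.hyps)
      show "simple_graph (W, ?E W)" using E W fin by (auto simp: simple_graph_def finite_subset)
      have sub: "?E W \<subseteq> E" by auto
      show "theta_free (?E W)" using less.prems(2) upath_mono[OF _ sub] unfolding theta_free_def by meson
      show "crossing_free (?E W)" using less.prems(3) ucycle_mono[OF _ sub] sub unfolding crossing_free_def by blast
      show "length xs \<noteq> k" if "ucycle (?E W) xs" for xs using less.prems(4) ucycle_mono[OF that sub] by blast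
    qed (use W in auto)
    \<comment> \<open>An edge counted on both sides would lie within \<open>{a}\<close>, which is
      too small.\<close>
    have "E = ?E V1 \<union> ?E V2" using sep by auto
    moreover have "?E V1 \<inter> ?E V2 = {}"
    proof -
      have "e \<subseteq> {a} \<Longrightarrow> card e \<noteq> 2" for e using card_mono[of "{a}" e] by auto
      then show ?thesis using E V(2) by blast
    qed
    moreover have "V1 \<subseteq> V" "V2 \<subseteq> V" using V(1) by blast+
    ultimately have "card E = card (?E V1) + card (?E V2)"
      using card_Un_disjoint[of "?E V1" "?E V2"] finE by simp
    then have "((int k)\<^sup>2 - 2 * int k - 1) * int (card E)
      \<le> (2 * int k - 5) * (int k * int (card V1) - int k - 1) + (2 * int k - 5) * (int k * int (card V2) - int k - 1)"
      using add_mono[OF part[of V1] part[of V2]] \<open>V1 \<subseteq> V\<close> \<open>V2 \<subseteq> V\<close> V(3,4) cV by (simp add: distrib_left)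
    also have "\<dots> = (2 * int k - 5) * (int k * int (card V1 + card V2) - 2 * int k - 2)" by (simp add: algebra_simps)
    also have "\<dots> \<le> (2 * int k - 5) * (int k * int (card V) - int k - 1)"
      unfolding cV using k by (intro mult_left_mono) (auto simp: algebra_simps)
    finally show ?thesis .
  next
    case False
    show ?thesis
    proof (cases "E = {}")
      case True
      have "int k * 2 \<le> int k * int (card V)" using less.prems by (intro mult_left_mono) auto
      then have "0 \<le> int k * int (card V) - int k - 1" using k by linarith
      then show ?thesis using True k by simp
    next
      case ne: False
      then obtain xs where "ucycle E xs" "set xs = V" using hamiltonian_cycle[OF less.prems(1) ne less.prems(2) False] by auto
      then show ?thesis using hamiltonian_edge_bound[OF k less.prems(1,3,4)] by blast
    qed
  qed
qed

section \<open>From the edge bound to the Turan number\<close>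

lemma contains_cycle_graph:
  assumes "simple_graph (V, E)" "ucycle E xs" "length xs = k"
  shows "contains_subgraph (V, E) (cycle_graph k)"
  unfolding contains_subgraph_def
proof (intro exI[of _ "(!) xs"] conjI)
  have dist: "distinct xs" and len: "2 \<le> length xs" and cE: "cycle_edges xs \<subseteq> E" using assms by (auto simp: ucycle_def)
  show "inj_on ((!) xs) (verts (cycle_graph k))"
    using dist assms(3) by (auto simp: cycle_graph_def inj_on_nth)
  have "\<Union>(path_edges xs) \<subseteq> V" using cE assms(1) by (auto simp: cycle_edges_def simple_graph_def)
  then show "(!) xs ` verts (cycle_graph k) \<subseteq> verts (V, E)"
    using assms(3) by (auto simp: cycle_graph_def Union_path_edges[OF len])
  show "\<forall>e\<in>edges (cycle_graph k). (!) xs ` e \<in> edges (V, E)"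
  proof
    fix e assume "e \<in> edges (cycle_graph k)"
    then obtain i where i: "e = {i, Suc i mod k}" "i < k" by (auto simp: cycle_graph_def)
    have "{xs ! i, xs ! (Suc i mod k)} \<in> E"
    proof (cases "Suc i = k")
      case True
      moreover have "xs \<noteq> []" using len by auto
      ultimately show ?thesis using cE assms(3) by (auto simp: cycle_edges_def last_conv_nth hd_conv_nth)
    next
      case False
      then show ?thesis using cE assms(3) i path_edges_nthI[of i xs] by (auto simp: cycle_edges_def)
    qed
    then show "(!) xs ` e \<in> edges (V, E)" using i by simp
  qed
qed

theorem theorem2:
  fixes n k :: nat
  assumes "n \<ge> 2" and "k \<ge> 3"
  shows "real (ex_OP n (cycle_graph k))
    \<le> (2 * real k - 5) * (real k * real n - real k - 1) / (real k ^ 2 - 2 * real k - 1)"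
proof -
  \<comment> \<open>The cycle has an edge, which guarantees that the maximum is attained by some
    graph.\<close>
  have "{0, Suc 0 mod k} \<in> edges (cycle_graph k)" using assms by (auto simp: cycle_graph_def)
  then obtain G :: "nat graph" where G: "simple_graph G" "card (verts G) = n" "outerplanar G"
    "\<not> contains_subgraph G (cycle_graph k)" "card (edges G) = ex_OP n (cycle_graph k)"
    using ex_OP_attained[of "cycle_graph k" n] by blast
  obtain V E where VE: "G = (V, E)" by fastforce
  obtain p c where "planar_drawing (V, E) p c" "p ` V \<subseteq> frontier (outside (drawing_image (V, E) p c))"
    using G(3) unfolding VE outerplanar_def by auto
  then interpret outerplanar_drawing V E p c using G VE by unfold_locales auto
  have "((int k)\<^sup>2 - 2 * int k - 1) * int (card E) \<le> (2 * int k - 5) * (int k * int (card V) - int k - 1)"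
    using edge_bound[OF assms(2) simple theta_free crossing_free] contains_cycle_graph[OF simple] G assms VE by auto
  then have "real_of_int (((int k)\<^sup>2 - 2 * int k - 1) * int (card E)) \<le> real_of_int ((2 * int k - 5) * (int k * int (card V) - int k - 1))"
    by (simp only: of_int_le_iff)
  then have *: "((real k)\<^sup>2 - 2 * real k - 1) * real (card E) \<le> (2 * real k - 5) * (real k * real n - real k - 1)"
    using G VE by simp
  \<comment> \<open>This makes the denominator at least \<open>k - 1\<close>, hence
    positive.\<close>
  have "3 * real k \<le> (real k)\<^sup>2" unfolding power2_eq_square using assms by (intro mult_right_mono) auto
  then have "(real k)\<^sup>2 - 2 * real k - 1 > 0" using assms by linarith
  then show ?thesis using * G VE by (simp add: pos_le_divide_eq mult.commute)
qed

end
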